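(* Let $\zeta\neq0$. The graviton propagator Feynman rule of (effective) Quantum General Relativity is $$\begin{aligned}\mathfrak{P}_{\mu_1\nu_1|\mu_2\nu_2}(p;\zeta;\epsilon)=-\frac{2i}{p^2+i\epsilon}\Big[&\big(\eta_{\mu_1\mu_2}\eta_{\nu_1\nu_2}+\eta_{\mu_1\nu_2}\eta_{\nu_1\mu_2}-\eta_{\mu_1\nu_1}\eta_{\mu_2\nu_2}\big)\\&-\Big(\frac{1-\zeta}{p^2}\Big)\big(\eta_{\mu_1\mu_2}p_{\nu_1}p_{\nu_2}+\eta_{\mu_1\nu_2}p_{\nu_1}p_{\mu_2}+\eta_{\nu_1\mu_2}p_{\mu_1}p_{\nu_2}+\eta_{\nu_1\nu_2}p_{\mu_1}p_{\mu_2}\big)\Big].\end{aligned}$$ That is, for every $p$ with $p^2\neq0$, the tensor $\mathfrak{P}(p;\zeta;0)$ is the inverse of the graviton $2$-point vertex Feynman rule $\mathfrak{G}_2(p;\zeta)$: $$\mathfrak{G}_2^{\mu_1\nu_1|\mu_2\nu_2}(p;\zeta)\,\mathfrak{P}_{\mu_2\nu_2|\mu_3\nu_3}(p;\zeta;0)=\tfrac12\big(\delta^{\mu_1}_{\mu_3}\delta^{\nu_1}_{\nu_3}+\delta^{\mu_1}_{\nu_3}\delta^{\nu_1}_{\mu_3}\big).$$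
   Context: Indices run over $0,\dots,3$, repeated indices are summed, $\eta=\mathrm{diag}(1,-1,-1,-1)$ raises and lowers indices, and $p^2=\eta_{\mu\nu}p^\mu p^\nu$. The graviton $2$-point vertex Feynman rule (metric decomposition $g_{\mu\nu}=\eta_{\mu\nu}+\varkappa h_{\mu\nu}$, linearized de Donder gauge fixing with gauge parameter $\zeta$) is $$\begin{aligned}\mathfrak{G}_2^{\mu_1\nu_1|\mu_2\nu_2}(p;\zeta)=\;&\frac{i}{4}\Big(1-\frac1\zeta\Big)\big(p^{\mu_1}p^{\nu_1}\eta^{\mu_2\nu_2}+p^{\mu_2}p^{\nu_2}\eta^{\mu_1\nu_1}\big)\\&-\frac{i}{8}\Big(1-\frac1\zeta\Big)\big(p^{\mu_1}p^{\mu_2}\eta^{\nu_1\nu_2}+p^{\mu_1}p^{\nu_2}\eta^{\nu_1\mu_2}+p^{\nu_1}p^{\mu_2}\eta^{\mu_1\nu_2}+p^{\nu_1}p^{\nu_2}\eta^{\mu_1\mu_2}\big)\\&-\frac{i}{4}\Big(1-\frac{1}{2\zeta}\Big)p^2\eta^{\mu_1\nu_1}\eta^{\mu_2\nu_2}+\frac{i}{8}\big(p^2\eta^{\mu_1\mu_2}\eta^{\nu_1\nu_2}+p^2\eta^{\mu_1\nu_2}\eta^{\nu_1\mu_2}\big).\end{aligned}$$ The propagator is by definition the inverse of $\mathfrak{G}_2(p;\zeta)$ on symmetric pairs of indices (each pair $\mu_i\nu_i$ treated as one index), with a regulator $\epsilon$ for Landau singularities: the overall prefactor $1/p^2$ is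 replaced by $1/(p^2+i\epsilon)$; the value at $\epsilon=0$ is the inverse itself. *)

theory Defs
  imports "HOL-Analysis.Analysis"
begin

text \<open>
  Spacetime indices are elements of the four-element type \<open>4\<close>, whose elements are
  \<open>0, 1, 2, 3\<close>; a momentum \<open>p :: real ^ 4\<close> lists the contravariant components, so
  \<open>p $ \<mu>\<close> is the component with upper index \<open>\<mu>\<close>.  The index \<open>4\<close> is the same as \<open>0\<close> in
  this type; \<open>0\<close> is the time direction.
\<close>

definition eta :: "4 \<Rightarrow> 4 \<Rightarrow> real" where
  "eta \<mu> \<nu> = (if \<mu> = \<nu> then (if \<mu> = 0 then 1 else - 1) else 0)"

definition delta :: "4 \<Rightarrow> 4 \<Rightarrow> complex" where
  "delta \<mu> \<nu> = (if \<mu> = \<nu> then 1 else 0)"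

definition lower :: "real ^ 4 \<Rightarrow> 4 \<Rightarrow> real" where
  "lower p \<mu> = (\<Sum>\<nu>\<in>UNIV. eta \<mu> \<nu> * p $ \<nu>)"

definition minkowski_sq :: "real ^ 4 \<Rightarrow> real" where
  "minkowski_sq p = (\<Sum>\<mu>\<in>UNIV. \<Sum>\<nu>\<in>UNIV. eta \<mu> \<nu> * p $ \<mu> * p $ \<nu>)"

text \<open>
  A tensor with two index pairs is written \<open>T \<mu>1 \<nu>1 \<mu>2 \<nu>2\<close>.  The matrices of \<open>\<eta>\<close> with both
  indices up and both indices down coincide, so \<open>eta\<close> serves for both.
\<close>

type_synonym pair_tensor = "4 \<Rightarrow> 4 \<Rightarrow> 4 \<Rightarrow> 4 \<Rightarrow> complex"

definition graviton_vertex2 :: "real ^ 4 \<Rightarrow> real \<Rightarrow> pair_tensor" where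
  "graviton_vertex2 p \<zeta> \<mu>1 \<nu>1 \<mu>2 \<nu>2 =
     \<i> / 4 * of_real ((1 - 1 / \<zeta>) *
       (p $ \<mu>1 * p $ \<nu>1 * eta \<mu>2 \<nu>2 + p $ \<mu>2 * p $ \<nu>2 * eta \<mu>1 \<nu>1))
   - \<i> / 8 * of_real ((1 - 1 / \<zeta>) *
       (p $ \<mu>1 * p $ \<mu>2 * eta \<nu>1 \<nu>2 + p $ \<mu>1 * p $ \<nu>2 * eta \<nu>1 \<mu>2
        + p $ \<nu>1 * p $ \<mu>2 * eta \<mu>1 \<nu>2 + p $ \<nu>1 * p $ \<nu>2 * eta \<mu>1 \<mu>2))
   - \<i> / 4 * of_real ((1 - 1 / (2 * \<zeta>)) * minkowski_sq p * eta \<mu>1 \<nu>1 * eta \<mu>2 \<nu>2)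
   + \<i> / 8 * of_real (minkowski_sq p * eta \<mu>1 \<mu>2 * eta \<nu>1 \<nu>2
        + minkowski_sq p * eta \<mu>1 \<nu>2 * eta \<nu>1 \<mu>2)"

definition contract :: "pair_tensor \<Rightarrow> pair_tensor \<Rightarrow> pair_tensor" where
  "contract S T \<mu>1 \<nu>1 \<mu>3 \<nu>3 = (\<Sum>\<mu>2\<in>UNIV. \<Sum>\<nu>2\<in>UNIV. S \<mu>1 \<nu>1 \<mu>2 \<nu>2 * T \<mu>2 \<nu>2 \<mu>3 \<nu>3)"

definition sym_identity :: pair_tensor where
  "sym_identity \<mu>1 \<nu>1 \<mu>2 \<nu>2 = 1 / 2 * (delta \<mu>1 \<mu>2 * delta \<nu>1 \<nu>2 + delta \<mu>1 \<nu>2 * delta \<nu>1 \<mu>2)"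

definition pair_symmetric :: "pair_tensor \<Rightarrow> bool" where
  "pair_symmetric T \<longleftrightarrow>
     (\<forall>\<mu>1 \<nu>1 \<mu>2 \<nu>2. T \<mu>1 \<nu>1 \<mu>2 \<nu>2 = T \<nu>1 \<mu>1 \<mu>2 \<nu>2 \<and> T \<mu>1 \<nu>1 \<mu>2 \<nu>2 = T \<mu>1 \<nu>1 \<nu>2 \<mu>2)"

definition is_pair_inverse :: "pair_tensor \<Rightarrow> pair_tensor \<Rightarrow> bool" where
  "is_pair_inverse G P \<longleftrightarrow>
     pair_symmetric P \<and> contract G P = sym_identity \<and> contract P G = sym_identity"

text \<open>
  Because \<open>P\<close> is required to be symmetric in each pair, there is at most one inverse: \<open>P\<close> is
  unchanged by contraction with \<open>sym_identity\<close>.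
\<close>

definition pair_inverse :: "pair_tensor \<Rightarrow> pair_tensor" where
  "pair_inverse G = (THE P. is_pair_inverse G P)"

text \<open>
  The propagator is the inverse of the 2-point vertex, with its overall prefactor \<open>1 / p\<^sup>2\<close>
  replaced by \<open>1 / (p\<^sup>2 + \<i> \<epsilon>)\<close>, i.e. the inverse multiplied by \<open>p\<^sup>2 / (p\<^sup>2 + \<i> \<epsilon>)\<close>.  Factors
  \<open>1 / p\<^sup>2\<close> inside the tensor structure are not regularised.  The definition is meaningful for
  \<open>p\<^sup>2 \<noteq> 0\<close> and \<open>\<zeta> \<noteq> 0\<close>; at \<open>\<epsilon> = 0\<close> it is the inverse itself.
\<close>

definition graviton_propagator :: "real ^ 4 \<Rightarrow> real \<Rightarrow> real \<Rightarrow> pair_tensor" where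
  "graviton_propagator p \<zeta> \<epsilon> \<mu>1 \<nu>1 \<mu>2 \<nu>2 =
     of_real (minkowski_sq p) / (of_real (minkowski_sq p) + \<i> * of_real \<epsilon>)
       * pair_inverse (graviton_vertex2 p \<zeta>) \<mu>1 \<nu>1 \<mu>2 \<nu>2"

end

theory Submission
  imports Defs
begin

text \<open>
  Contracting the vertex with a symmetric matrix \<open>b\<close> involves only the trace of \<open>b\<close>, the
  covector \<open>b p\<close>, the scalar \<open>p b p\<close> and \<open>b\<close> with both indices raised.  For \<open>b\<close> a slice of the
  claimed propagator these four quantities are explicit, and all terms of the product except
  the identity cancel.  Vertex and propagator are invariant under exchange of the two index
  pairs, so a right inverse is also a left inverse, and two-sided inverses are unique.
\<close>

section \<open>Raising, lowering and squaring with the diagonal metric\<close>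

lemma sum_eta: "(\<Sum>\<nu>\<in>UNIV. eta \<mu> \<nu> * f \<nu>) = eta \<mu> \<mu> * f \<mu>"
proof -
  have "(\<Sum>\<nu>\<in>UNIV. eta \<mu> \<nu> * f \<nu>) = (\<Sum>\<nu>\<in>UNIV. if \<mu> = \<nu> then eta \<mu> \<mu> * f \<mu> else 0)"
    by (rule sum.cong) (auto simp: eta_def)
  then show ?thesis by simp
qed

lemma eta_commute: "eta \<mu> \<nu> = eta \<nu> \<mu>"
  by (simp add: eta_def)

lemma eta_diag_sq: "eta \<mu> \<mu> * eta \<mu> \<mu> = 1"
  by (simp add: eta_def)

lemma lower_eq: "lower p \<mu> = eta \<mu> \<mu> * p $ \<mu>"
  by (simp add: lower_def sum_eta)

lemma minkowski_sq_eq: "minkowski_sq p = (\<Sum>\<mu>\<in>UNIV. p $ \<mu> * lower p \<mu>)"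
  by (simp add: minkowski_sq_def lower_eq sum_eta mult.assoc mult.left_commute)

lemma raise_lower: "eta \<mu> \<mu> * lower p \<mu> = p $ \<mu>"
  using eta_diag_sq[of \<mu>] by (simp add: lower_eq flip: mult.assoc)

lemma sum_momentum_eta: "(\<Sum>\<nu>\<in>UNIV. p $ \<nu> * eta \<nu> \<mu>) = lower p \<mu>"
  by (simp add: lower_def eta_commute mult.commute)

section \<open>Real cores of the two tensors, and the vertex contracted with a symmetric
  matrix\<close>

definition eta_trace :: "(4 \<Rightarrow> 4 \<Rightarrow> real) \<Rightarrow> real" where
  "eta_trace b = (\<Sum>\<mu>\<in>UNIV. eta \<mu> \<mu> * b \<mu> \<mu>)"

definition apply_momentum :: "(4 \<Rightarrow> 4 \<Rightarrow> real) \<Rightarrow> real ^ 4 \<Rightarrow> 4 \<Rightarrow> real" where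
  "apply_momentum b p \<nu> = (\<Sum>\<mu>\<in>UNIV. p $ \<mu> * b \<mu> \<nu>)"

text \<open>The common factor \<i>/8 is split off the vertex, so that the contractions take place
  over the reals.\<close>

definition vertex_core :: "real ^ 4 \<Rightarrow> real \<Rightarrow> 4 \<Rightarrow> 4 \<Rightarrow> 4 \<Rightarrow> 4 \<Rightarrow> real" where
  "vertex_core p \<zeta> \<mu>1 \<nu>1 \<mu>2 \<nu>2 =
     2 * (1 - 1 / \<zeta>) * (p $ \<mu>1 * p $ \<nu>1 * eta \<mu>2 \<nu>2 + p $ \<mu>2 * p $ \<nu>2 * eta \<mu>1 \<nu>1)
   - (1 - 1 / \<zeta>) *
       (p $ \<mu>1 * p $ \<mu>2 * eta \<nu>1 \<nu>2 + p $ \<mu>1 * p $ \<nu>2 * eta \<nu>1 \<mu>2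
        + p $ \<nu>1 * p $ \<mu>2 * eta \<mu>1 \<nu>2 + p $ \<nu>1 * p $ \<nu>2 * eta \<mu>1 \<mu>2)
   - 2 * (1 - 1 / (2 * \<zeta>)) * minkowski_sq p * eta \<mu>1 \<nu>1 * eta \<mu>2 \<nu>2
   + minkowski_sq p * (eta \<mu>1 \<mu>2 * eta \<nu>1 \<nu>2 + eta \<mu>1 \<nu>2 * eta \<nu>1 \<mu>2)"

text \<open>This is the bracket of the claimed propagator, without its prefactor -2\<i>/p^2.\<close>

definition propagator_core :: "real ^ 4 \<Rightarrow> real \<Rightarrow> 4 \<Rightarrow> 4 \<Rightarrow> 4 \<Rightarrow> 4 \<Rightarrow> real" where
  "propagator_core p \<zeta> \<mu>1 \<nu>1 \<mu>2 \<nu>2 =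
     (eta \<mu>1 \<mu>2 * eta \<nu>1 \<nu>2 + eta \<mu>1 \<nu>2 * eta \<nu>1 \<mu>2 - eta \<mu>1 \<nu>1 * eta \<mu>2 \<nu>2)
     - (1 - \<zeta>) / minkowski_sq p *
       (eta \<mu>1 \<mu>2 * lower p \<nu>1 * lower p \<nu>2 + eta \<mu>1 \<nu>2 * lower p \<nu>1 * lower p \<mu>2
        + eta \<nu>1 \<mu>2 * lower p \<mu>1 * lower p \<nu>2 + eta \<nu>1 \<nu>2 * lower p \<mu>1 * lower p \<mu>2)"

lemma graviton_vertex2_eq:
  "graviton_vertex2 p \<zeta> \<mu>1 \<nu>1 \<mu>2 \<nu>2 = \<i> / 8 * of_real (vertex_core p \<zeta> \<mu>1 \<nu>1 \<mu>2 \<nu>2)"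
  unfolding graviton_vertex2_def vertex_core_def
  by (simp add: algebra_simps)

lemma vertex_core_swap: "vertex_core p \<zeta> \<mu>1 \<nu>1 \<mu>2 \<nu>2 = vertex_core p \<zeta> \<mu>2 \<nu>2 \<mu>1 \<nu>1"
  unfolding vertex_core_def
  by (simp add: eta_commute algebra_simps)

lemma propagator_core_swap:
  "propagator_core p \<zeta> \<mu>1 \<nu>1 \<mu>2 \<nu>2 = propagator_core p \<zeta> \<mu>2 \<nu>2 \<mu>1 \<nu>1"
  unfolding propagator_core_def
  by (simp add: eta_commute algebra_simps)

lemma propagator_core_symmetric:
  "propagator_core p \<zeta> \<mu>1 \<nu>1 \<mu>2 \<nu>2 = propagator_core p \<zeta> \<nu>1 \<mu>1 \<mu>2 \<nu>2"
  "propagator_core p \<zeta> \<mu>1 \<nu>1 \<mu>2 \<nu>2 = propagator_core p \<zeta> \<mu>1 \<nu>1 \<nu>2 \<mu>2"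
  unfolding propagator_core_def
  by (simp_all add: eta_commute algebra_simps)

text \<open>Symmetry of \<open>b\<close> makes the four terms with one free momentum index coincide
  in two pairs, and likewise the last two metric terms; hence the factors 2. A propagator slice
  enters only through the quantities on the right.\<close>

lemma vertex_core_contract:
  assumes sym: "\<And>\<mu> \<nu>. b \<mu> \<nu> = b \<nu> \<mu>"
  shows "(\<Sum>\<mu>2\<in>UNIV. \<Sum>\<nu>2\<in>UNIV. vertex_core p \<zeta> \<mu>1 \<nu>1 \<mu>2 \<nu>2 * b \<mu>2 \<nu>2) =
     2 * (1 - 1 / \<zeta>) * (p $ \<mu>1 * p $ \<nu>1 * eta_trace b
       + eta \<mu>1 \<nu>1 * (\<Sum>\<nu>\<in>UNIV. p $ \<nu> * apply_momentum b p \<nu>))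
   - 2 * (1 - 1 / \<zeta>) * (p $ \<mu>1 * eta \<nu>1 \<nu>1 * apply_momentum b p \<nu>1
       + p $ \<nu>1 * eta \<mu>1 \<mu>1 * apply_momentum b p \<mu>1)
   - 2 * (1 - 1 / (2 * \<zeta>)) * minkowski_sq p * eta \<mu>1 \<nu>1 * eta_trace b
   + 2 * minkowski_sq p * eta \<mu>1 \<mu>1 * eta \<nu>1 \<nu>1 * b \<mu>1 \<nu>1"
proof -
  have trace: "(\<Sum>\<mu>\<in>UNIV. \<Sum>\<nu>\<in>UNIV. eta \<mu> \<nu> * b \<mu> \<nu>) = eta_trace b"
    by (simp add: sum_eta eta_trace_def)
  have quad: "(\<Sum>\<mu>\<in>UNIV. \<Sum>\<nu>\<in>UNIV. p $ \<mu> * p $ \<nu> * b \<mu> \<nu>)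
      = (\<Sum>\<nu>\<in>UNIV. p $ \<nu> * apply_momentum b p \<nu>)"
    unfolding apply_momentum_def
    \<comment> \<open>\<open>apply_momentum\<close> sums over the first index of \<open>b\<close>,
      so that sum has to become the inner one.\<close>
    by (subst sum.swap) (simp add: sum_distrib_left mult_ac)
  have mom_left: "(\<Sum>\<mu>\<in>UNIV. \<Sum>\<nu>\<in>UNIV. p $ \<mu> * eta \<alpha> \<nu> * b \<mu> \<nu>)
      = eta \<alpha> \<alpha> * apply_momentum b p \<alpha>" for \<alpha>
  proof -
    have "(\<Sum>\<mu>\<in>UNIV. \<Sum>\<nu>\<in>UNIV. p $ \<mu> * eta \<alpha> \<nu> * b \<mu> \<nu>)
        = (\<Sum>\<nu>\<in>UNIV. eta \<alpha> \<nu> * apply_momentum b p \<nu>)"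
      unfolding apply_momentum_def
      by (subst sum.swap) (simp add: sum_distrib_left mult_ac)
    then show ?thesis by (simp add: sum_eta)
  qed
  have mom_right: "(\<Sum>\<mu>\<in>UNIV. \<Sum>\<nu>\<in>UNIV. p $ \<nu> * eta \<alpha> \<mu> * b \<mu> \<nu>)
      = eta \<alpha> \<alpha> * apply_momentum b p \<alpha>" for \<alpha>
    using mom_left[of \<alpha>] by (subst sum.swap) (simp add: sym)
  \<comment> \<open>The nested shape is what remains of the last two summands below once factors
    independent of the inner index have been pulled out.\<close>
  have raised: "(\<Sum>\<mu>\<in>UNIV. eta \<alpha> \<mu> * (\<Sum>\<nu>\<in>UNIV. eta \<beta> \<nu> * b \<mu> \<nu>))
      = eta \<alpha> \<alpha> * eta \<beta> \<beta> * b \<alpha> \<beta>" for \<alpha> \<beta>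
    by (simp add: sum_eta)
  \<comment> \<open>Each summand is arranged as a constant times the pattern of one of the facts
    above.\<close>
  have "(\<Sum>\<mu>2\<in>UNIV. \<Sum>\<nu>2\<in>UNIV. vertex_core p \<zeta> \<mu>1 \<nu>1 \<mu>2 \<nu>2 * b \<mu>2 \<nu>2) =
    (\<Sum>\<mu>2\<in>UNIV. \<Sum>\<nu>2\<in>UNIV.
      2 * (1 - 1 / \<zeta>) * p $ \<mu>1 * p $ \<nu>1 * (eta \<mu>2 \<nu>2 * b \<mu>2 \<nu>2)
    + 2 * (1 - 1 / \<zeta>) * eta \<mu>1 \<nu>1 * (p $ \<mu>2 * p $ \<nu>2 * b \<mu>2 \<nu>2)
    - (1 - 1 / \<zeta>) * p $ \<mu>1 * (p $ \<mu>2 * eta \<nu>1 \<nu>2 * b \<mu>2 \<nu>2)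
    - (1 - 1 / \<zeta>) * p $ \<mu>1 * (p $ \<nu>2 * eta \<nu>1 \<mu>2 * b \<mu>2 \<nu>2)
    - (1 - 1 / \<zeta>) * p $ \<nu>1 * (p $ \<mu>2 * eta \<mu>1 \<nu>2 * b \<mu>2 \<nu>2)
    - (1 - 1 / \<zeta>) * p $ \<nu>1 * (p $ \<nu>2 * eta \<mu>1 \<mu>2 * b \<mu>2 \<nu>2)
    - 2 * (1 - 1 / (2 * \<zeta>)) * minkowski_sq p * eta \<mu>1 \<nu>1 * (eta \<mu>2 \<nu>2 * b \<mu>2 \<nu>2)
    + minkowski_sq p * (eta \<mu>1 \<mu>2 * (eta \<nu>1 \<nu>2 * b \<mu>2 \<nu>2))
    + minkowski_sq p * (eta \<nu>1 \<mu>2 * (eta \<mu>1 \<nu>2 * b \<mu>2 \<nu>2)))"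
    by (intro sum.cong refl) (simp add: vertex_core_def algebra_simps)
  also have "\<dots> =
      2 * (1 - 1 / \<zeta>) * p $ \<mu>1 * p $ \<nu>1 * eta_trace b
    + 2 * (1 - 1 / \<zeta>) * eta \<mu>1 \<nu>1 * (\<Sum>\<nu>\<in>UNIV. p $ \<nu> * apply_momentum b p \<nu>)
    - (1 - 1 / \<zeta>) * p $ \<mu>1 * (eta \<nu>1 \<nu>1 * apply_momentum b p \<nu>1)
    - (1 - 1 / \<zeta>) * p $ \<mu>1 * (eta \<nu>1 \<nu>1 * apply_momentum b p \<nu>1)
    - (1 - 1 / \<zeta>) * p $ \<nu>1 * (eta \<mu>1 \<mu>1 * apply_momentum b p \<mu>1)
    - (1 - 1 / \<zeta>) * p $ \<nu>1 * (eta \<mu>1 \<mu>1 * apply_momentum b p \<mu>1)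
    - 2 * (1 - 1 / (2 * \<zeta>)) * minkowski_sq p * eta \<mu>1 \<nu>1 * eta_trace b
    + minkowski_sq p * (eta \<mu>1 \<mu>1 * eta \<nu>1 \<nu>1 * b \<mu>1 \<nu>1)
    + minkowski_sq p * (eta \<nu>1 \<nu>1 * eta \<mu>1 \<mu>1 * b \<nu>1 \<mu>1)"
    by (simp only: sum.distrib sum_subtractf sum_distrib_left[symmetric]
        trace quad mom_left mom_right raised)
  finally show ?thesis
    by (simp add: sym[of \<nu>1 \<mu>1] algebra_simps)
qed

section \<open>Contractions of a propagator slice, and the product of the two cores\<close>

lemma eta_trace_propagator_core:
  "eta_trace (\<lambda>\<mu> \<nu>. propagator_core p \<zeta> \<mu> \<nu> \<alpha> \<beta>) =
     - 2 * eta \<alpha> \<beta> - 4 * ((1 - \<zeta>) / minkowski_sq p) * lower p \<alpha> * lower p \<beta>"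
proof -
  define c where "c = (1 - \<zeta>) / minkowski_sq p"
  have single: "(\<Sum>\<mu>\<in>UNIV. eta \<gamma> \<mu> * (eta \<mu> \<mu> * f \<mu>)) = f \<gamma>" for \<gamma> f
    unfolding sum_eta by (simp add: eta_diag_sq flip: mult.assoc)
  \<comment> \<open>The dimension of spacetime enters here: the coefficient of
    \<open>eta \<alpha> \<beta>\<close> becomes 1 + 1 - 4 = -2.\<close>
  have four: "(\<Sum>\<mu>\<in>(UNIV::4 set). eta \<mu> \<mu> * eta \<mu> \<mu>) = 4"
    by (simp add: eta_diag_sq)
  have "eta_trace (\<lambda>\<mu> \<nu>. propagator_core p \<zeta> \<mu> \<nu> \<alpha> \<beta>) =
    (\<Sum>\<mu>\<in>UNIV. eta \<alpha> \<mu> * (eta \<mu> \<mu> * eta \<mu> \<beta>) + eta \<alpha> \<mu> * (eta \<mu> \<mu> * eta \<mu> \<beta>)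
       - eta \<alpha> \<beta> * (eta \<mu> \<mu> * eta \<mu> \<mu>)
       - 2 * c * lower p \<beta> * (eta \<alpha> \<mu> * (eta \<mu> \<mu> * lower p \<mu>))
       - 2 * c * lower p \<alpha> * (eta \<beta> \<mu> * (eta \<mu> \<mu> * lower p \<mu>)))"
    unfolding eta_trace_def propagator_core_def c_def[symmetric]
    by (intro sum.cong refl) (simp add: eta_commute algebra_simps)
  also have "\<dots> = eta \<alpha> \<beta> + eta \<alpha> \<beta> - eta \<alpha> \<beta> * 4
       - 2 * c * lower p \<beta> * lower p \<alpha> - 2 * c * lower p \<alpha> * lower p \<beta>"
    by (simp only: sum.distrib sum_subtractf sum_distrib_left[symmetric] single four)
  finally show ?thesis unfolding c_def[symmetric] by (simp add: algebra_simps)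
qed

text \<open>In two of the four momentum terms the contraction produces p^2, which cancels the
  denominator and lowers the coefficient of the mixed metric terms from 1 to 1 - (1 - \<zeta>) =
  \<zeta>. The other two keep the factor 1/p^2.\<close>

lemma apply_momentum_propagator_core:
  assumes "minkowski_sq p \<noteq> 0"
  shows "apply_momentum (\<lambda>\<mu> \<nu>. propagator_core p \<zeta> \<mu> \<nu> \<alpha> \<beta>) p \<nu> =
     \<zeta> * (lower p \<alpha> * eta \<nu> \<beta> + lower p \<beta> * eta \<nu> \<alpha>) - lower p \<nu> * eta \<alpha> \<beta>
     - 2 * ((1 - \<zeta>) / minkowski_sq p) * lower p \<alpha> * lower p \<beta> * lower p \<nu>"
proof -
  \<comment> \<open>Naming the quotient hides the division: the closing call of
    \<open>algebra\<close> uses only the polynomial relation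
    \<open>c * minkowski_sq p = 1 - \<zeta>\<close>.\<close>
  define c where "c = (1 - \<zeta>) / minkowski_sq p"
  have c: "c * minkowski_sq p = 1 - \<zeta>"
    using assms by (simp add: c_def)
  have "apply_momentum (\<lambda>\<mu> \<nu>. propagator_core p \<zeta> \<mu> \<nu> \<alpha> \<beta>) p \<nu> =
    (\<Sum>\<mu>\<in>UNIV. eta \<nu> \<beta> * (p $ \<mu> * eta \<mu> \<alpha>) + eta \<nu> \<alpha> * (p $ \<mu> * eta \<mu> \<beta>)
       - eta \<alpha> \<beta> * (p $ \<mu> * eta \<mu> \<nu>)
       - c * lower p \<nu> * lower p \<beta> * (p $ \<mu> * eta \<mu> \<alpha>)
       - c * lower p \<nu> * lower p \<alpha> * (p $ \<mu> * eta \<mu> \<beta>)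
       - c * eta \<nu> \<alpha> * lower p \<beta> * (p $ \<mu> * lower p \<mu>)
       - c * eta \<nu> \<beta> * lower p \<alpha> * (p $ \<mu> * lower p \<mu>))"
    unfolding apply_momentum_def propagator_core_def c_def[symmetric]
    by (intro sum.cong refl) (simp add: algebra_simps)
  also have "\<dots> = eta \<nu> \<beta> * lower p \<alpha> + eta \<nu> \<alpha> * lower p \<beta> - eta \<alpha> \<beta> * lower p \<nu>
       - c * lower p \<nu> * lower p \<beta> * lower p \<alpha> - c * lower p \<nu> * lower p \<alpha> * lower p \<beta>
       - c * eta \<nu> \<alpha> * lower p \<beta> * minkowski_sq p - c * eta \<nu> \<beta> * lower p \<alpha> * minkowski_sq p"
    by (simp only: sum.distrib sum_subtractf sum_distrib_left[symmetric]
        sum_momentum_eta minkowski_sq_eq[symmetric])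
  finally show ?thesis unfolding c_def[symmetric] using c by algebra
qed

text \<open>The second contraction with p turns the remaining 1/p^2 into a constant as well:
  2\<zeta> - 2(1 - \<zeta>) = 4\<zeta> - 2.\<close>

lemma momentum_momentum_propagator_core:
  assumes "minkowski_sq p \<noteq> 0"
  shows "(\<Sum>\<nu>\<in>UNIV. p $ \<nu> * apply_momentum (\<lambda>\<mu> \<nu>. propagator_core p \<zeta> \<mu> \<nu> \<alpha> \<beta>) p \<nu>) =
     (4 * \<zeta> - 2) * lower p \<alpha> * lower p \<beta> - minkowski_sq p * eta \<alpha> \<beta>"
proof -
  define c where "c = (1 - \<zeta>) / minkowski_sq p"
  have c: "c * minkowski_sq p = 1 - \<zeta>"
    using assms by (simp add: c_def)
  have "(\<Sum>\<nu>\<in>UNIV. p $ \<nu> * apply_momentum (\<lambda>\<mu> \<nu>. propagator_core p \<zeta> \<mu> \<nu> \<alpha> \<beta>) p \<nu>) =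
    (\<Sum>\<nu>\<in>UNIV. \<zeta> * lower p \<alpha> * (p $ \<nu> * eta \<nu> \<beta>) + \<zeta> * lower p \<beta> * (p $ \<nu> * eta \<nu> \<alpha>)
       - eta \<alpha> \<beta> * (p $ \<nu> * lower p \<nu>)
       - 2 * c * lower p \<alpha> * lower p \<beta> * (p $ \<nu> * lower p \<nu>))"
    unfolding apply_momentum_propagator_core[OF assms] c_def[symmetric]
    by (intro sum.cong refl) (simp add: algebra_simps)
  also have "\<dots> = \<zeta> * lower p \<alpha> * lower p \<beta> + \<zeta> * lower p \<beta> * lower p \<alpha>
       - eta \<alpha> \<beta> * minkowski_sq p - 2 * c * lower p \<alpha> * lower p \<beta> * minkowski_sq p"
    by (simp only: sum.distrib sum_subtractf sum_distrib_left[symmetric]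
        sum_momentum_eta minkowski_sq_eq[symmetric])
  finally show ?thesis using c by algebra
qed

text \<open>Terms with both free indices on momenta cancel between the trace and the covector
  \<open>b p\<close>. Terms with \<open>eta \<mu>1 \<nu>1\<close> cancel between trace, p b p and
  the raised slice. Terms with one free index on a momentum and the other on a Kronecker symbol
  cancel because (1 - 1/\<zeta>) \<zeta> = -(1 - \<zeta>). Only the Kronecker products survive, with
  coefficient 2 p^2.\<close>

lemma vertex_core_propagator_core:
  assumes "\<zeta> \<noteq> 0" and m: "minkowski_sq p \<noteq> 0"
  shows "(\<Sum>\<mu>2\<in>UNIV. \<Sum>\<nu>2\<in>UNIV.
      vertex_core p \<zeta> \<mu>1 \<nu>1 \<mu>2 \<nu>2 * propagator_core p \<zeta> \<mu>2 \<nu>2 \<alpha> \<beta>) =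
    2 * minkowski_sq p *
      ((if \<mu>1 = \<alpha> then 1 else 0) * (if \<nu>1 = \<beta> then 1 else 0)
       + (if \<mu>1 = \<beta> then 1 else 0) * (if \<nu>1 = \<alpha> then 1 else 0))"
proof -
  \<comment> \<open>With z = 1/(2\<zeta>), both 1/\<zeta> = 2z and 1/(2\<zeta>) become polynomial,
    and the hypotheses on \<zeta> and p^2 turn into polynomial relations for
    \<open>algebra\<close>.\<close>
  define c z where "c = (1 - \<zeta>) / minkowski_sq p" and "z = 1 / (2 * \<zeta>)"
  have c: "c * minkowski_sq p = 1 - \<zeta>" and z: "2 * z * \<zeta> = 1" and inv_zeta: "1 / \<zeta> = 2 * z"
    using assms by (simp_all add: c_def z_def)
  have mixed: "eta \<mu> \<mu> * eta \<mu> \<nu> = (if \<mu> = \<nu> then 1 else 0)" for \<mu> \<nu>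
    by (simp add: eta_def)
  have mixed_diag: "eta \<mu> \<mu> * eta \<nu> \<nu> * eta \<mu> \<nu> = eta \<mu> \<nu>" for \<mu> \<nu>
    by (simp add: eta_def)
  \<comment> \<open>Every diagonal metric factor is grouped with a partner: \<open>mixed\<close>
    makes the metric pairs Kronecker symbols, \<open>raise_lower\<close> makes the momentum pairs
    contravariant components.\<close>
  have raised: "eta \<mu>1 \<mu>1 * eta \<nu>1 \<nu>1 * propagator_core p \<zeta> \<mu>1 \<nu>1 \<alpha> \<beta> =
      (eta \<mu>1 \<mu>1 * eta \<mu>1 \<alpha>) * (eta \<nu>1 \<nu>1 * eta \<nu>1 \<beta>)
      + (eta \<mu>1 \<mu>1 * eta \<mu>1 \<beta>) * (eta \<nu>1 \<nu>1 * eta \<nu>1 \<alpha>)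
      - eta \<mu>1 \<mu>1 * eta \<nu>1 \<nu>1 * eta \<mu>1 \<nu>1 * eta \<alpha> \<beta>
      - c * ((eta \<mu>1 \<mu>1 * eta \<mu>1 \<alpha>) * (eta \<nu>1 \<nu>1 * lower p \<nu>1) * lower p \<beta>
        + (eta \<mu>1 \<mu>1 * eta \<mu>1 \<beta>) * (eta \<nu>1 \<nu>1 * lower p \<nu>1) * lower p \<alpha>
        + (eta \<nu>1 \<nu>1 * eta \<nu>1 \<alpha>) * (eta \<mu>1 \<mu>1 * lower p \<mu>1) * lower p \<beta>
        + (eta \<nu>1 \<nu>1 * eta \<nu>1 \<beta>) * (eta \<mu>1 \<mu>1 * lower p \<mu>1) * lower p \<alpha>)"
    unfolding propagator_core_def c_def[symmetric] by (simp add: algebra_simps)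
  have momentum: "eta \<nu> \<nu> * (\<zeta> * (lower p \<alpha> * eta \<nu> \<beta> + lower p \<beta> * eta \<nu> \<alpha>)
        - lower p \<nu> * eta \<alpha> \<beta> - 2 * c * lower p \<alpha> * lower p \<beta> * lower p \<nu>) =
      \<zeta> * (lower p \<alpha> * (eta \<nu> \<nu> * eta \<nu> \<beta>) + lower p \<beta> * (eta \<nu> \<nu> * eta \<nu> \<alpha>))
        - (eta \<nu> \<nu> * lower p \<nu>) * eta \<alpha> \<beta>
        - 2 * c * lower p \<alpha> * lower p \<beta> * (eta \<nu> \<nu> * lower p \<nu>)" for \<nu>
    by (simp add: algebra_simps)
  \<comment> \<open>Behind a name, the Kronecker symbol is an atom for \<open>algebra\<close>
    instead of a conditional.\<close>
  define d where "d \<mu> \<nu> = (if \<mu> = \<nu> then 1 else 0 :: real)" for \<mu> \<nu> :: 4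
  note mixed = mixed[folded d_def]
  show ?thesis
    unfolding d_def[symmetric] vertex_core_contract[OF propagator_core_symmetric(1)]
      momentum_momentum_propagator_core[OF m]
    \<comment> \<open>This comes after the scalar p b p has been evaluated, whose pattern contains
      \<open>apply_momentum\<close>. The \<open>mult.assoc\<close> instances regroup products so
      that the left sides of \<open>momentum\<close> and \<open>raised\<close> occur
      literally.\<close>
    unfolding eta_trace_propagator_core apply_momentum_propagator_core[OF m]
      c_def[symmetric] z_def[symmetric] inv_zeta mult.assoc[of "_ $ _" "eta _ _"] momentum
      mult.assoc[of "2 * minkowski_sq p" "eta \<mu>1 \<mu>1"]
      mult.assoc[of "2 * minkowski_sq p" "eta \<mu>1 \<mu>1 * eta \<nu>1 \<nu>1"]
    unfolding raised mixed mixed_diag raise_lower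
    using c z by algebra
qed

section \<open>Contraction as a product with partial unit, and uniqueness of inverses\<close>

lemma contract_assoc: "contract (contract S T) U = contract S (contract T U)"
proof (intro ext)
  fix \<mu>1 \<nu>1 \<mu>3 \<nu>3
  \<comment> \<open>Treating an index pair as one index turns contraction into a matrix product, so
    a single exchange of sums gives associativity.\<close>
  have pairs: "(\<Sum>\<mu>\<in>UNIV. \<Sum>\<nu>\<in>UNIV. f \<mu> \<nu>) = (\<Sum>q\<in>UNIV. f (fst q) (snd q))"
    for f :: "4 \<Rightarrow> 4 \<Rightarrow> complex"
    by (simp add: sum.cartesian_product case_prod_beta)
  show "contract (contract S T) U \<mu>1 \<nu>1 \<mu>3 \<nu>3 = contract S (contract T U) \<mu>1 \<nu>1 \<mu>3 \<nu>3"
    unfolding contract_def pairs sum_distrib_left sum_distrib_right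
    by (subst sum.swap) (simp add: mult.assoc)
qed

lemma sum_delta_mult:
  "(\<Sum>\<nu>\<in>UNIV. delta \<mu> \<nu> * f \<nu>) = f \<mu>" "(\<Sum>\<nu>\<in>UNIV. delta \<nu> \<mu> * f \<nu>) = f \<mu>"
  by (simp_all add: delta_def if_distrib[of "\<lambda>x. x * _"] cong: if_cong)

text \<open>Contraction with \<open>sym_identity\<close> averages over the two orders of an index
  pair, which fixes a tensor symmetric in that pair. Contraction from the left acts on the first
  pair, from the right on the second.\<close>

lemma contract_sym_identity_left:
  assumes "pair_symmetric T"
  shows "contract sym_identity T = T"
proof (intro ext)
  fix \<mu>1 \<nu>1 \<mu>3 \<nu>3
  have "contract sym_identity T \<mu>1 \<nu>1 \<mu>3 \<nu>3 =
      1 / 2 * ((\<Sum>\<mu>\<in>UNIV. delta \<mu>1 \<mu> * (\<Sum>\<nu>\<in>UNIV. delta \<nu>1 \<nu> * T \<mu> \<nu> \<mu>3 \<nu>3))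
        + (\<Sum>\<mu>\<in>UNIV. delta \<nu>1 \<mu> * (\<Sum>\<nu>\<in>UNIV. delta \<mu>1 \<nu> * T \<mu> \<nu> \<mu>3 \<nu>3)))"
    unfolding contract_def sym_identity_def sum_distrib_left sum.distrib[symmetric]
    by (intro sum.cong refl) (simp add: algebra_simps)
  also have "\<dots> = T \<mu>1 \<nu>1 \<mu>3 \<nu>3"
    using assms unfolding sum_delta_mult pair_symmetric_def by simp
  finally show "contract sym_identity T \<mu>1 \<nu>1 \<mu>3 \<nu>3 = T \<mu>1 \<nu>1 \<mu>3 \<nu>3" .
qed

lemma contract_sym_identity_right:
  assumes "pair_symmetric T"
  shows "contract T sym_identity = T"
proof (intro ext)
  fix \<mu>1 \<nu>1 \<mu>3 \<nu>3
  have "contract T sym_identity \<mu>1 \<nu>1 \<mu>3 \<nu>3 =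
      1 / 2 * ((\<Sum>\<mu>\<in>UNIV. delta \<mu> \<mu>3 * (\<Sum>\<nu>\<in>UNIV. delta \<nu> \<nu>3 * T \<mu>1 \<nu>1 \<mu> \<nu>))
        + (\<Sum>\<mu>\<in>UNIV. delta \<mu> \<nu>3 * (\<Sum>\<nu>\<in>UNIV. delta \<nu> \<mu>3 * T \<mu>1 \<nu>1 \<mu> \<nu>)))"
    unfolding contract_def sym_identity_def sum_distrib_left sum.distrib[symmetric]
    by (intro sum.cong refl) (simp add: algebra_simps)
  also have "\<dots> = 1 / 2 * (T \<mu>1 \<nu>1 \<mu>3 \<nu>3 + T \<mu>1 \<nu>1 \<nu>3 \<mu>3)"
    unfolding sum_delta_mult ..
  also have "T \<mu>1 \<nu>1 \<nu>3 \<mu>3 = T \<mu>1 \<nu>1 \<mu>3 \<nu>3"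
    using assms unfolding pair_symmetric_def by blast
  also have "1 / 2 * (T \<mu>1 \<nu>1 \<mu>3 \<nu>3 + T \<mu>1 \<nu>1 \<mu>3 \<nu>3) = T \<mu>1 \<nu>1 \<mu>3 \<nu>3"
    by simp
  finally show "contract T sym_identity \<mu>1 \<nu>1 \<mu>3 \<nu>3 = T \<mu>1 \<nu>1 \<mu>3 \<nu>3" .
qed

text \<open>The monoid argument P = P (G Q) = (P G) Q = Q applies, since the pair symmetry demanded
  of inverses makes \<open>sym_identity\<close> neutral for both P and Q.\<close>

lemma is_pair_inverse_unique:
  assumes "is_pair_inverse G P" "is_pair_inverse G Q"
  shows "P = Q"
proof -
  have "P = contract P (contract G Q)"
    using assms contract_sym_identity_right[of P] by (simp add: is_pair_inverse_def)
  also have "\<dots> = Q"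
    unfolding contract_assoc[symmetric]
    using assms contract_sym_identity_left[of Q] by (simp add: is_pair_inverse_def)
  finally show ?thesis .
qed

lemma pair_inverse_eqI: "is_pair_inverse G P \<Longrightarrow> pair_inverse G = P"
  unfolding pair_inverse_def using is_pair_inverse_unique by blast

section \<open>The explicit inverse of the vertex, and the regularised propagator\<close>

lemma is_pair_inverse_graviton_vertex2:
  assumes "\<zeta> \<noteq> 0" and "minkowski_sq p \<noteq> 0"
  shows "is_pair_inverse (graviton_vertex2 p \<zeta>)
     (\<lambda>\<mu>1 \<nu>1 \<mu>2 \<nu>2. - (2 * \<i> / of_real (minkowski_sq p))
        * of_real (propagator_core p \<zeta> \<mu>1 \<nu>1 \<mu>2 \<nu>2))"
    (is "is_pair_inverse ?G ?P")
proof -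
  have right: "contract ?G ?P = sym_identity"
  proof (intro ext)
    fix \<mu>1 \<nu>1 \<mu>3 \<nu>3
    \<comment> \<open>The prefactors multiply to (\<i>/8)(-2\<i>/p^2) = 1/(4 p^2); against the 2 p^2
      of the core product this leaves the 1/2 of \<open>sym_identity\<close>.\<close>
    have "contract ?G ?P \<mu>1 \<nu>1 \<mu>3 \<nu>3 =
        1 / (4 * of_real (minkowski_sq p)) * of_real (\<Sum>\<mu>2\<in>UNIV. \<Sum>\<nu>2\<in>UNIV.
          vertex_core p \<zeta> \<mu>1 \<nu>1 \<mu>2 \<nu>2 * propagator_core p \<zeta> \<mu>2 \<nu>2 \<mu>3 \<nu>3)"
      unfolding contract_def graviton_vertex2_eq of_real_sum sum_distrib_left
      by (intro sum.cong refl) (simp add: field_simps)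
    also have "\<dots> = sym_identity \<mu>1 \<nu>1 \<mu>3 \<nu>3"
      unfolding vertex_core_propagator_core[OF assms]
      using assms by (simp add: sym_identity_def delta_def)
    finally show "contract ?G ?P \<mu>1 \<nu>1 \<mu>3 \<nu>3 = sym_identity \<mu>1 \<nu>1 \<mu>3 \<nu>3" .
  qed
  have left: "contract ?P ?G = sym_identity"
  proof (intro ext)
    fix \<mu>1 \<nu>1 \<mu>3 \<nu>3
    \<comment> \<open>Exchange of the index pairs is transposition. Both factors are invariant under
      it, so P G is the transpose of G P, and \<open>sym_identity\<close> is its own
      transpose.\<close>
    have "contract ?P ?G \<mu>1 \<nu>1 \<mu>3 \<nu>3 = contract ?G ?P \<mu>3 \<nu>3 \<mu>1 \<nu>1"
      unfolding contract_def graviton_vertex2_eq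
      by (intro sum.cong refl)
        (simp add: vertex_core_swap[of _ _ \<mu>3] propagator_core_swap[of _ _ \<mu>1] mult.commute)
    also have "\<dots> = sym_identity \<mu>1 \<nu>1 \<mu>3 \<nu>3"
      unfolding right by (auto simp: sym_identity_def delta_def)
    finally show "contract ?P ?G \<mu>1 \<nu>1 \<mu>3 \<nu>3 = sym_identity \<mu>1 \<nu>1 \<mu>3 \<nu>3" .
  qed
  have "pair_symmetric ?P"
    unfolding pair_symmetric_def using propagator_core_symmetric by metis
  with right left show ?thesis
    unfolding is_pair_inverse_def by blast
qed

theorem theorem4p12:
  fixes p :: "real ^ 4" and \<zeta> :: real
  assumes "\<zeta> \<noteq> 0" and "minkowski_sq p \<noteq> 0"
  shows "(\<forall>\<epsilon> \<mu>1 \<nu>1 \<mu>2 \<nu>2. graviton_propagator p \<zeta> \<epsilon> \<mu>1 \<nu>1 \<mu>2 \<nu>2 =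
            - (2 * \<i> / (of_real (minkowski_sq p) + \<i> * of_real \<epsilon>)) * of_real (
                (eta \<mu>1 \<mu>2 * eta \<nu>1 \<nu>2 + eta \<mu>1 \<nu>2 * eta \<nu>1 \<mu>2 - eta \<mu>1 \<nu>1 * eta \<mu>2 \<nu>2)
                - (1 - \<zeta>) / minkowski_sq p *
                  (eta \<mu>1 \<mu>2 * lower p \<nu>1 * lower p \<nu>2 + eta \<mu>1 \<nu>2 * lower p \<nu>1 * lower p \<mu>2
                   + eta \<nu>1 \<mu>2 * lower p \<mu>1 * lower p \<nu>2 + eta \<nu>1 \<nu>2 * lower p \<mu>1 * lower p \<mu>2)))
       \<and> is_pair_inverse (graviton_vertex2 p \<zeta>) (graviton_propagator p \<zeta> 0)
       \<and> (\<forall>\<mu>1 \<nu>1 \<mu>3 \<nu>3.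
            (\<Sum>\<mu>2\<in>UNIV. \<Sum>\<nu>2\<in>UNIV. graviton_vertex2 p \<zeta> \<mu>1 \<nu>1 \<mu>2 \<nu>2
                                   * graviton_propagator p \<zeta> 0 \<mu>2 \<nu>2 \<mu>3 \<nu>3)
            = 1 / 2 * (delta \<mu>1 \<mu>3 * delta \<nu>1 \<nu>3 + delta \<mu>1 \<nu>3 * delta \<nu>1 \<mu>3))"
proof -
  note inv = is_pair_inverse_graviton_vertex2[OF assms]
  \<comment> \<open>At \<epsilon> = 0 the regulator factor is p^2/p^2, which is 1 because p^2 is
    nonzero.\<close>
  have at_zero: "graviton_propagator p \<zeta> 0 = (\<lambda>\<mu>1 \<nu>1 \<mu>2 \<nu>2.
      - (2 * \<i> / of_real (minkowski_sq p)) * of_real (propagator_core p \<zeta> \<mu>1 \<nu>1 \<mu>2 \<nu>2))"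
    using assms by (intro ext) (simp add: graviton_propagator_def pair_inverse_eqI[OF inv])
  have inv0: "is_pair_inverse (graviton_vertex2 p \<zeta>) (graviton_propagator p \<zeta> 0)"
    using inv unfolding at_zero .
  then have "contract (graviton_vertex2 p \<zeta>) (graviton_propagator p \<zeta> 0) = sym_identity"
    by (simp add: is_pair_inverse_def)
  from fun_cong[OF fun_cong[OF fun_cong[OF fun_cong[OF this]]]]
  have "(\<Sum>\<mu>2\<in>UNIV. \<Sum>\<nu>2\<in>UNIV.
      graviton_vertex2 p \<zeta> \<mu>1 \<nu>1 \<mu>2 \<nu>2 * graviton_propagator p \<zeta> 0 \<mu>2 \<nu>2 \<mu>3 \<nu>3) =
      1 / 2 * (delta \<mu>1 \<mu>3 * delta \<nu>1 \<nu>3 + delta \<mu>1 \<nu>3 * delta \<nu>1 \<mu>3)" for \<mu>1 \<nu>1 \<mu>3 \<nu>3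
    unfolding contract_def sym_identity_def .
  \<comment> \<open>For general \<epsilon> the numerator p^2 of the regulator factor cancels the
    overall 1/p^2 of the inverse, leaving 1/(p^2 + \<i>\<epsilon>); the 1/p^2 inside the core
    stays.\<close>
  moreover have "graviton_propagator p \<zeta> \<epsilon> \<mu>1 \<nu>1 \<mu>2 \<nu>2 =
      - (2 * \<i> / (of_real (minkowski_sq p) + \<i> * of_real \<epsilon>))
        * of_real (propagator_core p \<zeta> \<mu>1 \<nu>1 \<mu>2 \<nu>2)" for \<epsilon> \<mu>1 \<nu>1 \<mu>2 \<nu>2
    unfolding graviton_propagator_def pair_inverse_eqI[OF inv] using assms by simp
  ultimately show ?thesis
    using inv0 unfolding propagator_core_def by blast
qed

end
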